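(* Let $\mathcal{K}$ be a field, $\Gamma\leq\mathbb{R}$ an additive subgroup, $\Lambda=\Lambda^{\mathcal{K},\Gamma}$. Let $(C_1\xrightarrow{\partial}C_0)$ be a two-term Floer-type complex over $\Lambda$ with filtration function $\ell$, and let $((y_1,\dots,y_n),(x_1,\dots,x_m))$ be a singular value decomposition for $\partial\colon C_1\to C_0$. Then for every positive integer $k$, $$\beta_k(\partial)=\begin{cases}\ell(y_k)-\ell(x_k)&1\leq k\leq r\\0&k>r\end{cases}$$ where $r$ is the rank of $\partial$.
   Context: **Novikov field.** $\Lambda=\Lambda^{\mathcal{K},\Gamma}$ is the field of formal sums $\sum_{g\in\Gamma}a_gT^g$ with $a_g\in\mathcal{K}$ such that for every $C\in\mathbb{R}$ only finitely many $g<C$ have $a_g\neq 0$, with power-series addition and multiplication. Its valuation is $\nu(\sum a_gT^g)=\min\{g\mid a_g\neq 0\}$, $\nu(0)=\infty$. **Orthogonalizable spaces.** A non-Archimedean normed vector space over $\Lambda$ is a pair $(C,\ell)$ with $C$ a $\Lambda$-vector space and $\ell\colon C\to\mathbb{R}\cup\{-\infty\}$ satisfying: $\ell(x)=-\infty$ iff $x=0$; $\ell(\lambda x)=\ell(x)-\nu(\lambda)$; $\ell(x+y)\leq\max\{\ell(x),\ell(y)\}$. A finite ordered collection $(w_1,\dots,w_r)$ in $C$ is orthogonal if $\ell(\sum_i\lambda_iw_i)=\max_i\ell(\lambda_iw_i)$ for all $\lambda_i\in\Lambda$. An orthogonalizable $\Lambda$-space is a finite-dimensional non-Archimedean normed vector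 space admitting an orthogonal basis. **Singular value decomposition.** Let $A\colon C\to D$ be a $\Lambda$-linear map of rank $r$ between orthogonalizable $\Lambda$-spaces. A singular value decomposition of $A$ is a choice of orthogonal ordered bases $(y_1,\dots,y_n)$ for $C$ and $(x_1,\dots,x_m)$ for $D$ such that: $(y_{r+1},\dots,y_n)$ is an orthogonal ordered basis for $\ker A$; $(x_1,\dots,x_r)$ is an orthogonal ordered basis for $\mathrm{Im}\,A$; $Ay_i=x_i$ for $i\in\{1,\dots,r\}$; $\ell_C(y_1)-\ell_D(x_1)\geq\cdots\geq\ell_C(y_r)-\ell_D(x_r)$. **Two-term Floer-type complex.** $(C_1\xrightarrow{\partial}C_0)$ consists of orthogonalizable $\Lambda$-spaces $C_1,C_0$ (both filtration functions denoted $\ell$) and a $\Lambda$-linear map $\partial\colon C_1\to C_0$ with $\ell(\partial x)\leq\ell(x)$ for all $x\in C_1$. **Robustness and $\beta_k$.** For $\delta\in\mathbb{R}$, an element $x\in C_0$ is $\delta$-robust if every $y\in C_1$ with $\partial y=x$ satisfies $\ell(y)>\ell(x)+\delta$. A subspace $V\leq C_0$ is $\delta$-robust if every $x\in V\setminus\{0\}$ is $\delta$-robust. For a positive integer $k$, $$\beta_k(\partial)=\sup\big(\{0\}\cup\{\delta\geq 0\mid\text{there exists a }\delta\text{-robust subspace }V\leq\mathrm{Im}\,\partial\text{ with }\dim V=k\}\big).$$ *)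

theory Defs
  imports Complex_Main "HOL-Library.Extended_Real"
    "Jordan_Normal_Form.Missing_VectorSpace"
begin

section \<open>The Novikov field\<close>

definition real_add_group :: "real monoid" where
  "real_add_group = \<lparr>carrier = UNIV, mult = (+), one = 0\<rparr>"

text \<open>A formal sum $\sum_g a_g T^g$ is encoded by its coefficient function $g \mapsto a_g$ on
  the reals, which has to vanish outside \<open>\<Gamma>\<close>. For \<open>a\<close> and \<open>b\<close> in the carrier, the index set of
  the sum in the product is finite, so that \<^const>\<open>finsum\<close> is the intended sum.\<close>

definition novikov :: "('k, 'm) ring_scheme \<Rightarrow> real set \<Rightarrow> (real \<Rightarrow> 'k) ring" where
  "novikov K \<Gamma> =
    \<lparr>carrier = {a. (\<forall>g. a g \<in> carrier K) \<and> (\<forall>g. g \<notin> \<Gamma> \<longrightarrow> a g = \<zero>\<^bsub>K\<^esub>) \<and>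
                   (\<forall>C. finite {g. g < C \<and> a g \<noteq> \<zero>\<^bsub>K\<^esub>})},
     mult = (\<lambda>a b g. \<Oplus>\<^bsub>K\<^esub>h\<in>{h. a h \<noteq> \<zero>\<^bsub>K\<^esub> \<and> b (g - h) \<noteq> \<zero>\<^bsub>K\<^esub>}. a h \<otimes>\<^bsub>K\<^esub> b (g - h)),
     one = (\<lambda>g. if g = 0 then \<one>\<^bsub>K\<^esub> else \<zero>\<^bsub>K\<^esub>),
     zero = (\<lambda>g. \<zero>\<^bsub>K\<^esub>),
     add = (\<lambda>a b g. a g \<oplus>\<^bsub>K\<^esub> b g)\<rparr>"

definition novikov_val :: "('k, 'm) ring_scheme \<Rightarrow> (real \<Rightarrow> 'k) \<Rightarrow> ereal" where
  "novikov_val K a = (if \<forall>g. a g = \<zero>\<^bsub>K\<^esub> then \<infinity> else ereal (LEAST g. a g \<noteq> \<zero>\<^bsub>K\<^esub>))"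

locale novikov_data = K?: field K for K (structure) +
  fixes \<Gamma> :: "real set"
  assumes subgroup: "subgroup \<Gamma> real_add_group"
begin

abbreviation \<Lambda> where "\<Lambda> \<equiv> novikov K \<Gamma>"

lemma G_zero: "0 \<in> \<Gamma>"
  using subgroup.one_closed[OF subgroup] by (simp add: real_add_group_def)

lemma G_add: "x \<in> \<Gamma> \<Longrightarrow> y \<in> \<Gamma> \<Longrightarrow> x + y \<in> \<Gamma>"
  using subgroup.m_closed[OF subgroup] by (simp add: real_add_group_def)

lemma G_uminus: assumes "x \<in> \<Gamma>" shows "- x \<in> \<Gamma>"
proof -
  have "group real_add_group"
    by (rule groupI) (auto simp: real_add_group_def intro: exI[of _ "- x" for x])
  then have "inv\<^bsub>real_add_group\<^esub> x = - x"
    by (intro group.inv_equality) (auto simp: real_add_group_def)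
  with subgroup.m_inv_closed[OF subgroup assms] show ?thesis by simp
qed

lemma zero_L: "\<zero>\<^bsub>\<Lambda>\<^esub> = (\<lambda>g. \<zero>)"
  and one_L: "\<one>\<^bsub>\<Lambda>\<^esub> = (\<lambda>g. if g = 0 then \<one> else \<zero>)"
  and add_L: "a \<oplus>\<^bsub>\<Lambda>\<^esub> b = (\<lambda>g. a g \<oplus> b g)"
  and mult_L: "(a \<otimes>\<^bsub>\<Lambda>\<^esub> b) g = (\<Oplus>h\<in>{h. a h \<noteq> \<zero> \<and> b (g - h) \<noteq> \<zero>}. a h \<otimes> b (g - h))"
  by (simp_all add: novikov_def)

lemma carrier_L: "a \<in> carrier \<Lambda> \<longleftrightarrow> (\<forall>g. a g \<in> carrier K) \<and> (\<forall>g. g \<notin> \<Gamma> \<longrightarrow> a g = \<zero>) \<and>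
    (\<forall>C. finite {g. g < C \<and> a g \<noteq> \<zero>})"
  by (simp add: novikov_def)

lemma coeff [simp]: "a \<in> carrier \<Lambda> \<Longrightarrow> a g \<in> carrier K"
  by (simp add: carrier_L)

lemma left_finite: "a \<in> carrier \<Lambda> \<Longrightarrow> finite {g. g < C \<and> a g \<noteq> \<zero>}"
  by (simp add: carrier_L)

lemma lower_bound:
  assumes "a \<in> carrier \<Lambda>"
  obtains m where "\<And>g. a g \<noteq> \<zero> \<Longrightarrow> m \<le> g"
proof -
  have f: "finite (insert 0 {g. g < 0 \<and> a g \<noteq> \<zero>})" using left_finite[OF assms] by simp
  show thesis
  proof (rule that)
    fix g assume "a g \<noteq> \<zero>"
    then show "Min (insert 0 {g. g < 0 \<and> a g \<noteq> \<zero>}) \<le> g"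
      by (cases "g < 0") (auto intro: Min_le[OF f] order_trans[OF Min_le[OF f, of 0]])
  qed
qed

lemma min_attained:
  assumes "a \<in> carrier \<Lambda>" and "a g1 \<noteq> \<zero>"
  obtains g0 where "a g0 \<noteq> \<zero>" and "\<And>g. a g \<noteq> \<zero> \<Longrightarrow> g0 \<le> g"
proof -
  let ?S = "{g. g < g1 + 1 \<and> a g \<noteq> \<zero>}"
  have f: "finite ?S" using left_finite[OF assms(1)] .
  have ne: "g1 \<in> ?S" using assms by simp
  have "Min ?S \<in> ?S" using f ne Min_in by blast
  moreover have "Min ?S \<le> g" if "a g \<noteq> \<zero>" for g
    using that Min_le[OF f, of g] Min_le[OF f ne] by (cases "g < g1 + 1") auto
  ultimately show thesis using that[of "Min ?S"] by blast
qed

lemma finite_conv: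
  assumes "a \<in> carrier \<Lambda>" "b \<in> carrier \<Lambda>"
  shows "finite {h. a h \<noteq> \<zero> \<and> b (g - h) \<noteq> \<zero>}"
proof -
  obtain m where m: "\<And>g. b g \<noteq> \<zero> \<Longrightarrow> m \<le> g" using lower_bound[OF assms(2)] by blast
  have "{h. a h \<noteq> \<zero> \<and> b (g - h) \<noteq> \<zero>} \<subseteq> {h. h < g - m + 1 \<and> a h \<noteq> \<zero>}"
    using m by fastforce
  then show ?thesis using left_finite[OF assms(1)] finite_subset by blast
qed

lemma mult_L_superset:
  assumes "a \<in> carrier \<Lambda>" "b \<in> carrier \<Lambda>" "finite S"
    "\<And>h. a h \<noteq> \<zero> \<Longrightarrow> b (g - h) \<noteq> \<zero> \<Longrightarrow> h \<in> S"
  shows "(a \<otimes>\<^bsub>\<Lambda>\<^esub> b) g = (\<Oplus>h\<in>S. a h \<otimes> b (g - h))"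
  unfolding mult_L
proof (rule add.finprod_mono_neutral_cong_left[OF assms(3)])
  show "{h. a h \<noteq> \<zero> \<and> b (g - h) \<noteq> \<zero>} \<subseteq> S" using assms(4) by blast
  show "\<And>i. i \<in> S - {h. a h \<noteq> \<zero> \<and> b (g - h) \<noteq> \<zero>} \<Longrightarrow> a i \<otimes> b (g - i) = \<zero>"
    using assms(1,2) by auto
  show "(\<lambda>i. a i \<otimes> b (g - i)) \<in> S \<rightarrow> carrier K" using assms(1,2) by auto
qed auto

lemma mult_L_coeff:
  assumes "a \<in> carrier \<Lambda>" "b \<in> carrier \<Lambda>"
  shows "(a \<otimes>\<^bsub>\<Lambda>\<^esub> b) g \<in> carrier K"
  unfolding mult_L using assms by (intro finsum_closed) auto

lemma mult_L_supp:
  assumes "(a \<otimes>\<^bsub>\<Lambda>\<^esub> b) g \<noteq> \<zero>"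
  obtains h where "a h \<noteq> \<zero>" "b (g - h) \<noteq> \<zero>"
proof (rule ccontr)
  assume "\<not> thesis"
  then have "{h. a h \<noteq> \<zero> \<and> b (g - h) \<noteq> \<zero>} = {}" using that by blast
  then show False using assms finsum_empty unfolding mult_L by metis
qed

lemma add_L_closed:
  assumes "a \<in> carrier \<Lambda>" "b \<in> carrier \<Lambda>"
  shows "a \<oplus>\<^bsub>\<Lambda>\<^esub> b \<in> carrier \<Lambda>"
proof -
  have "finite {g. g < C \<and> a g \<oplus> b g \<noteq> \<zero>}" for C
    by (rule finite_subset[OF _ finite_UnI[OF left_finite[OF assms(1), of C] left_finite[OF assms(2), of C]]])
       auto
  then show ?thesis using assms unfolding carrier_L add_L by auto
qed

lemma mult_L_closed:
  assumes "a \<in> carrier \<Lambda>" "b \<in> carrier \<Lambda>"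
  shows "a \<otimes>\<^bsub>\<Lambda>\<^esub> b \<in> carrier \<Lambda>"
proof -
  obtain m where m: "\<And>g. a g \<noteq> \<zero> \<Longrightarrow> m \<le> g" using lower_bound[OF assms(1)] by blast
  obtain n where n: "\<And>g. b g \<noteq> \<zero> \<Longrightarrow> n \<le> g" using lower_bound[OF assms(2)] by blast
  have "finite {g. g < C \<and> (a \<otimes>\<^bsub>\<Lambda>\<^esub> b) g \<noteq> \<zero>}" for C
  proof (rule finite_subset)
    let ?A = "{g. g < C - n \<and> a g \<noteq> \<zero>}" and ?B = "{g. g < C - m \<and> b g \<noteq> \<zero>}"
    show "finite ((\<lambda>(x, y). x + y) ` (?A \<times> ?B))"
      using left_finite[OF assms(1)] left_finite[OF assms(2)] by blast
    show "{g. g < C \<and> (a \<otimes>\<^bsub>\<Lambda>\<^esub> b) g \<noteq> \<zero>} \<subseteq> (\<lambda>(x, y). x + y) ` (?A \<times> ?B)"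
    proof
      fix g assume g: "g \<in> {g. g < C \<and> (a \<otimes>\<^bsub>\<Lambda>\<^esub> b) g \<noteq> \<zero>}"
      then obtain h where h: "a h \<noteq> \<zero>" "b (g - h) \<noteq> \<zero>" using mult_L_supp by blast
      then have "(h, g - h) \<in> ?A \<times> ?B" using g m[OF h(1)] n[OF h(2)] by auto
      then show "g \<in> (\<lambda>(x, y). x + y) ` (?A \<times> ?B)" by (rule rev_image_eqI) simp
    qed
  qed
  moreover have "(a \<otimes>\<^bsub>\<Lambda>\<^esub> b) g = \<zero>" if "g \<notin> \<Gamma>" for g
  proof (rule ccontr)
    assume "(a \<otimes>\<^bsub>\<Lambda>\<^esub> b) g \<noteq> \<zero>"
    then obtain h where h: "a h \<noteq> \<zero>" "b (g - h) \<noteq> \<zero>" using mult_L_supp by blast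
    then have "h \<in> \<Gamma>" "g - h \<in> \<Gamma>" using assms unfolding carrier_L by blast+
    then show False using G_add[of h "g - h"] that by simp
  qed
  ultimately show ?thesis using assms mult_L_coeff unfolding carrier_L[of "a \<otimes>\<^bsub>\<Lambda>\<^esub> b"] by auto
qed

lemma finsum_swap:
  assumes "finite A" "finite B" "\<And>x y. x \<in> A \<Longrightarrow> y \<in> B \<Longrightarrow> f x y \<in> carrier K"
  shows "(\<Oplus>x\<in>A. \<Oplus>y\<in>B. f x y) = (\<Oplus>y\<in>B. \<Oplus>x\<in>A. f x y)"
  using assms(1,3)
proof (induction A rule: finite_induct)
  case empty
  then show ?case by simp
next
  case (insert a A)
  have "(\<Oplus>x\<in>insert a A. \<Oplus>y\<in>B. f x y) = (\<Oplus>y\<in>B. f a y) \<oplus> (\<Oplus>y\<in>B. \<Oplus>x\<in>A. f x y)"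
    using insert by (subst finsum_insert) (auto intro!: finsum_closed)
  also have "\<dots> = (\<Oplus>y\<in>B. f a y \<oplus> (\<Oplus>x\<in>A. f x y))"
    using insert by (subst finsum_addf) (auto intro!: finsum_closed)
  also have "\<dots> = (\<Oplus>y\<in>B. \<Oplus>x\<in>insert a A. f x y)"
    using insert by (intro finsum_cong') (auto intro!: finsum_closed)
  finally show ?case .
qed

lemma mult_L_comm:
  assumes "a \<in> carrier \<Lambda>" "b \<in> carrier \<Lambda>"
  shows "a \<otimes>\<^bsub>\<Lambda>\<^esub> b = b \<otimes>\<^bsub>\<Lambda>\<^esub> a"
proof
  fix g
  let ?S = "{h. a h \<noteq> \<zero> \<and> b (g - h) \<noteq> \<zero>}"
  have inj: "inj_on (\<lambda>h. g - h) ?S" by (auto intro: inj_onI)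
  have "(b \<otimes>\<^bsub>\<Lambda>\<^esub> a) g = (\<Oplus>h\<in>(\<lambda>h. g - h) ` ?S. b h \<otimes> a (g - h))"
  proof (rule mult_L_superset[OF assms(2,1)])
    show "finite ((\<lambda>h. g - h) ` ?S)" using finite_conv[OF assms] by simp
    fix h assume h: "b h \<noteq> \<zero>" "a (g - h) \<noteq> \<zero>"
    show "h \<in> (\<lambda>h. g - h) ` ?S" by (rule image_eqI[of _ _ "g - h"]) (use h in auto)
  qed
  also have "\<dots> = (\<Oplus>h\<in>?S. b (g - h) \<otimes> a h)"
    using assms by (subst finsum_reindex[OF _ inj]) auto
  also have "\<dots> = (a \<otimes>\<^bsub>\<Lambda>\<^esub> b) g"
    unfolding mult_L using assms by (intro finsum_cong') (auto intro: m_comm)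
  finally show "(a \<otimes>\<^bsub>\<Lambda>\<^esub> b) g = (b \<otimes>\<^bsub>\<Lambda>\<^esub> a) g" by simp
qed

lemma mult_L_distr:
  assumes "a \<in> carrier \<Lambda>" "b \<in> carrier \<Lambda>" "c \<in> carrier \<Lambda>"
  shows "(a \<oplus>\<^bsub>\<Lambda>\<^esub> b) \<otimes>\<^bsub>\<Lambda>\<^esub> c = a \<otimes>\<^bsub>\<Lambda>\<^esub> c \<oplus>\<^bsub>\<Lambda>\<^esub> b \<otimes>\<^bsub>\<Lambda>\<^esub> c"
proof
  fix g
  let ?S = "{h. a h \<noteq> \<zero> \<and> c (g - h) \<noteq> \<zero>} \<union> {h. b h \<noteq> \<zero> \<and> c (g - h) \<noteq> \<zero>}"
  have f: "finite ?S" using finite_conv assms by simp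
  have "((a \<oplus>\<^bsub>\<Lambda>\<^esub> b) \<otimes>\<^bsub>\<Lambda>\<^esub> c) g = (\<Oplus>h\<in>?S. (a \<oplus>\<^bsub>\<Lambda>\<^esub> b) h \<otimes> c (g - h))"
    by (rule mult_L_superset[OF add_L_closed[OF assms(1,2)] assms(3) f]) (auto simp: add_L)
  also have "\<dots> = (\<Oplus>h\<in>?S. a h \<otimes> c (g - h) \<oplus> b h \<otimes> c (g - h))"
    using assms by (intro finsum_cong') (auto simp: add_L l_distr)
  also have "\<dots> = (\<Oplus>h\<in>?S. a h \<otimes> c (g - h)) \<oplus> (\<Oplus>h\<in>?S. b h \<otimes> c (g - h))"
    using assms by (intro finsum_addf) auto
  also have "(\<Oplus>h\<in>?S. a h \<otimes> c (g - h)) = (a \<otimes>\<^bsub>\<Lambda>\<^esub> c) g"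
    by (rule mult_L_superset[OF assms(1,3) f, symmetric]) auto
  also have "(\<Oplus>h\<in>?S. b h \<otimes> c (g - h)) = (b \<otimes>\<^bsub>\<Lambda>\<^esub> c) g"
    by (rule mult_L_superset[OF assms(2,3) f, symmetric]) auto
  finally show "((a \<oplus>\<^bsub>\<Lambda>\<^esub> b) \<otimes>\<^bsub>\<Lambda>\<^esub> c) g = (a \<otimes>\<^bsub>\<Lambda>\<^esub> c \<oplus>\<^bsub>\<Lambda>\<^esub> b \<otimes>\<^bsub>\<Lambda>\<^esub> c) g"
    by (simp add: add_L)
qed

lemma mult_L_assoc:
  assumes "a \<in> carrier \<Lambda>" "b \<in> carrier \<Lambda>" "c \<in> carrier \<Lambda>"
  shows "(a \<otimes>\<^bsub>\<Lambda>\<^esub> b) \<otimes>\<^bsub>\<Lambda>\<^esub> c = a \<otimes>\<^bsub>\<Lambda>\<^esub> (b \<otimes>\<^bsub>\<Lambda>\<^esub> c)"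
proof
  fix g
  obtain ma where ma: "\<And>g. a g \<noteq> \<zero> \<Longrightarrow> ma \<le> g" using lower_bound[OF assms(1)] by blast
  obtain mb where mb: "\<And>g. b g \<noteq> \<zero> \<Longrightarrow> mb \<le> g" using lower_bound[OF assms(2)] by blast
  obtain mc where mc: "\<And>g. c g \<noteq> \<zero> \<Longrightarrow> mc \<le> g" using lower_bound[OF assms(3)] by blast
  define A where "A = {x. x < g - mb - mc + 1 \<and> a x \<noteq> \<zero>}"
  define B where "B = {y. y < g - ma - mc + 1 \<and> b y \<noteq> \<zero>}"
  define H where "H = (\<lambda>(x, y). x + y) ` (A \<times> B)"
  have fA: "finite A" unfolding A_def by (rule left_finite[OF assms(1)])
  have fB: "finite B" unfolding B_def by (rule left_finite[OF assms(2)])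
  have fH: "finite H" unfolding H_def using fA fB by simp
  have HI: "h \<in> H" if "a x \<noteq> \<zero>" "b (h - x) \<noteq> \<zero>" "c (g - h) \<noteq> \<zero>" for h x
  proof -
    have "(x, h - x) \<in> A \<times> B"
      using that ma[OF that(1)] mb[OF that(2)] mc[OF that(3)] by (auto simp: A_def B_def)
    then show ?thesis unfolding H_def by (rule rev_image_eqI) simp
  qed
  have "((a \<otimes>\<^bsub>\<Lambda>\<^esub> b) \<otimes>\<^bsub>\<Lambda>\<^esub> c) g = (\<Oplus>h\<in>H. (a \<otimes>\<^bsub>\<Lambda>\<^esub> b) h \<otimes> c (g - h))"
    by (rule mult_L_superset[OF mult_L_closed[OF assms(1,2)] assms(3) fH]) (auto elim!: mult_L_supp intro: HI)
  also have "\<dots> = (\<Oplus>h\<in>H. \<Oplus>x\<in>A. a x \<otimes> b (h - x) \<otimes> c (g - h))"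
  proof (rule finsum_cong')
    show "(\<lambda>h. \<Oplus>x\<in>A. a x \<otimes> b (h - x) \<otimes> c (g - h)) \<in> H \<rightarrow> carrier K"
      using assms by (auto intro!: finsum_closed)
    fix h assume "h \<in> H"
    show "(a \<otimes>\<^bsub>\<Lambda>\<^esub> b) h \<otimes> c (g - h) = (\<Oplus>x\<in>A. a x \<otimes> b (h - x) \<otimes> c (g - h))"
    proof (cases "c (g - h) = \<zero>")
      case True
      have "(\<Oplus>x\<in>A. a x \<otimes> b (h - x) \<otimes> c (g - h)) = (\<Oplus>x\<in>A. \<zero>)"
        using assms True by (intro finsum_cong') auto
      then show ?thesis using True mult_L_coeff assms by simp
    next
      case False
      have "(a \<otimes>\<^bsub>\<Lambda>\<^esub> b) h = (\<Oplus>x\<in>A. a x \<otimes> b (h - x))"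
      proof (rule mult_L_superset[OF assms(1,2) fA])
        fix x assume "a x \<noteq> \<zero>" "b (h - x) \<noteq> \<zero>"
        then show "x \<in> A" using mb[of "h - x"] mc[OF False] by (auto simp: A_def)
      qed
      then show ?thesis using assms fA by (auto intro!: finsum_ldistr)
    qed
  qed simp
  also have "\<dots> = (\<Oplus>x\<in>A. \<Oplus>h\<in>H. a x \<otimes> b (h - x) \<otimes> c (g - h))"
    using assms by (intro finsum_swap fA fH) auto
  also have "\<dots> = (\<Oplus>x\<in>A. a x \<otimes> (b \<otimes>\<^bsub>\<Lambda>\<^esub> c) (g - x))"
  proof (rule finsum_cong')
    show "(\<lambda>x. a x \<otimes> (b \<otimes>\<^bsub>\<Lambda>\<^esub> c) (g - x)) \<in> A \<rightarrow> carrier K"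
      using assms mult_L_coeff by auto
    fix x assume "x \<in> A"
    then have ax: "a x \<noteq> \<zero>" by (simp add: A_def)
    have inj: "inj_on (\<lambda>h. h - x) H" by (auto intro: inj_onI)
    have "(b \<otimes>\<^bsub>\<Lambda>\<^esub> c) (g - x) = (\<Oplus>y\<in>(\<lambda>h. h - x) ` H. b y \<otimes> c (g - x - y))"
    proof (rule mult_L_superset[OF assms(2,3)])
      show "finite ((\<lambda>h. h - x) ` H)" using fH by simp
      fix y assume y: "b y \<noteq> \<zero>" "c (g - x - y) \<noteq> \<zero>"
      have "x + y \<in> H" by (rule HI[OF ax]) (use y in \<open>auto simp: algebra_simps\<close>)
      then show "y \<in> (\<lambda>h. h - x) ` H" by (rule rev_image_eqI) simp
    qed
    also have "\<dots> = (\<Oplus>h\<in>H. b (h - x) \<otimes> c (g - h))"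
      using assms by (subst finsum_reindex[OF _ inj]) (auto simp: algebra_simps)
    finally have "a x \<otimes> (b \<otimes>\<^bsub>\<Lambda>\<^esub> c) (g - x) = (\<Oplus>h\<in>H. a x \<otimes> (b (h - x) \<otimes> c (g - h)))"
      using assms fH by (simp add: finsum_rdistr Pi_def)
    also have "\<dots> = (\<Oplus>h\<in>H. a x \<otimes> b (h - x) \<otimes> c (g - h))"
      using assms by (intro finsum_cong') (auto simp: m_assoc)
    finally show "(\<Oplus>h\<in>H. a x \<otimes> b (h - x) \<otimes> c (g - h)) = a x \<otimes> (b \<otimes>\<^bsub>\<Lambda>\<^esub> c) (g - x)" by simp
  qed simp
  also have "\<dots> = (a \<otimes>\<^bsub>\<Lambda>\<^esub> (b \<otimes>\<^bsub>\<Lambda>\<^esub> c)) g"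
  proof (rule mult_L_superset[OF assms(1) mult_L_closed[OF assms(2,3)] fA, symmetric])
    fix x assume x: "a x \<noteq> \<zero>" "(b \<otimes>\<^bsub>\<Lambda>\<^esub> c) (g - x) \<noteq> \<zero>"
    then obtain y where "b y \<noteq> \<zero>" "c (g - x - y) \<noteq> \<zero>" using mult_L_supp by blast
    then show "x \<in> A" using x mb[of y] mc[of "g - x - y"] by (auto simp: A_def)
  qed
  finally show "((a \<otimes>\<^bsub>\<Lambda>\<^esub> b) \<otimes>\<^bsub>\<Lambda>\<^esub> c) g = (a \<otimes>\<^bsub>\<Lambda>\<^esub> (b \<otimes>\<^bsub>\<Lambda>\<^esub> c)) g" .
qed

lemma monom_L:
  assumes "k \<in> carrier K" "s \<in> \<Gamma>"
  shows "(\<lambda>g. if g = s then k else \<zero>) \<in> carrier \<Lambda>"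
proof -
  have "finite {g. g < C \<and> (if g = s then k else \<zero>) \<noteq> \<zero>}" for C
    by (rule finite_subset[of _ "{s}"]) auto
  then show ?thesis using assms unfolding carrier_L by auto
qed

lemma monom_mult:
  assumes "k \<in> carrier K" "s \<in> \<Gamma>" "a \<in> carrier \<Lambda>"
  shows "((\<lambda>g. if g = s then k else \<zero>) \<otimes>\<^bsub>\<Lambda>\<^esub> a) g = k \<otimes> a (g - s)"
proof -
  have "((\<lambda>g. if g = s then k else \<zero>) \<otimes>\<^bsub>\<Lambda>\<^esub> a) g =
      (\<Oplus>h\<in>{s}. (if h = s then k else \<zero>) \<otimes> a (g - h))"
    by (rule mult_L_superset[OF monom_L[OF assms(1,2)] assms(3)]) (auto split: if_splits)
  then show ?thesis using assms by simp
qed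

lemma one_L_closed: "\<one>\<^bsub>\<Lambda>\<^esub> \<in> carrier \<Lambda>"
  using monom_L[OF one_closed G_zero] by (simp add: one_L)

lemma cring_L: "cring \<Lambda>"
proof (rule cringI)
  show "abelian_group \<Lambda>"
  proof (rule abelian_groupI)
    fix x assume x: "x \<in> carrier \<Lambda>"
    have "finite {g. g < C \<and> \<ominus> x g \<noteq> \<zero>}" for C
      by (rule finite_subset[OF _ left_finite[OF x, of C]]) auto
    then have "(\<lambda>g. \<ominus> x g) \<in> carrier \<Lambda>"
      using x unfolding carrier_L by auto
    moreover have "(\<lambda>g. \<ominus> x g) \<oplus>\<^bsub>\<Lambda>\<^esub> x = \<zero>\<^bsub>\<Lambda>\<^esub>"
      using x by (auto simp: add_L zero_L l_neg)
    ultimately show "\<exists>y\<in>carrier \<Lambda>. y \<oplus>\<^bsub>\<Lambda>\<^esub> x = \<zero>\<^bsub>\<Lambda>\<^esub>" by blast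
  next
    show "\<zero>\<^bsub>\<Lambda>\<^esub> \<in> carrier \<Lambda>" by (simp add: zero_L carrier_L)
  next
    fix x y z assume "x \<in> carrier \<Lambda>" "y \<in> carrier \<Lambda>" "z \<in> carrier \<Lambda>"
    then show "x \<oplus>\<^bsub>\<Lambda>\<^esub> y \<oplus>\<^bsub>\<Lambda>\<^esub> z = x \<oplus>\<^bsub>\<Lambda>\<^esub> (y \<oplus>\<^bsub>\<Lambda>\<^esub> z)" by (simp add: add_L a_assoc)
  next
    fix x y assume "x \<in> carrier \<Lambda>" "y \<in> carrier \<Lambda>"
    then show "x \<oplus>\<^bsub>\<Lambda>\<^esub> y = y \<oplus>\<^bsub>\<Lambda>\<^esub> x" by (simp add: add_L a_comm)
  next
    fix x assume "x \<in> carrier \<Lambda>"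
    then show "\<zero>\<^bsub>\<Lambda>\<^esub> \<oplus>\<^bsub>\<Lambda>\<^esub> x = x" by (simp add: add_L zero_L)
  qed (rule add_L_closed)
  show "comm_monoid \<Lambda>"
  proof (rule comm_monoidI)
    fix x assume x: "x \<in> carrier \<Lambda>"
    show "\<one>\<^bsub>\<Lambda>\<^esub> \<otimes>\<^bsub>\<Lambda>\<^esub> x = x"
      using monom_mult[OF one_closed G_zero x] x by (auto simp: one_L)
  qed (auto intro: mult_L_closed one_L_closed mult_L_assoc mult_L_comm)
qed (rule mult_L_distr)

lemma mult_L_local:
  assumes "\<And>y. a y \<noteq> \<zero> \<Longrightarrow> e \<le> y" and "\<And>y. y \<le> x - e \<Longrightarrow> b y = b' y"
    and "a \<in> carrier \<Lambda>" "b' \<in> carrier \<Lambda>"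
  shows "(a \<otimes>\<^bsub>\<Lambda>\<^esub> b) x = (a \<otimes>\<^bsub>\<Lambda>\<^esub> b') x"
  unfolding mult_L
proof (rule finsum_cong')
  have *: "b (x - h) = b' (x - h)" if "a h \<noteq> \<zero>" for h
    using assms(1)[OF that] by (intro assms(2)) simp
  show "{h. a h \<noteq> \<zero> \<and> b (x - h) \<noteq> \<zero>} = {h. a h \<noteq> \<zero> \<and> b' (x - h) \<noteq> \<zero>}" using * by auto
  show "\<And>i. i \<in> {h. a h \<noteq> \<zero> \<and> b' (x - h) \<noteq> \<zero>} \<Longrightarrow> a i \<otimes> b (x - i) = a i \<otimes> b' (x - i)" using * by auto
qed (use assms in auto)

text \<open>Inversion of \<open>1 - h\<close> by the geometric series, for \<open>h\<close> of positive valuation.\<close>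

lemma geometric:
  assumes h: "h \<in> carrier \<Lambda>" and e: "e > 0" and supp: "\<And>y. h y \<noteq> \<zero> \<Longrightarrow> e \<le> y"
  obtains u where "u \<in> carrier \<Lambda>" "u = \<one>\<^bsub>\<Lambda>\<^esub> \<oplus>\<^bsub>\<Lambda>\<^esub> h \<otimes>\<^bsub>\<Lambda>\<^esub> u"
proof -
  define U where "U = rec_nat \<zero>\<^bsub>\<Lambda>\<^esub> (\<lambda>_ v. \<one>\<^bsub>\<Lambda>\<^esub> \<oplus>\<^bsub>\<Lambda>\<^esub> h \<otimes>\<^bsub>\<Lambda>\<^esub> v)"
  have U0: "U 0 = \<zero>\<^bsub>\<Lambda>\<^esub>" and US: "\<And>n. U (Suc n) = \<one>\<^bsub>\<Lambda>\<^esub> \<oplus>\<^bsub>\<Lambda>\<^esub> h \<otimes>\<^bsub>\<Lambda>\<^esub> U n"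
    by (simp_all add: U_def)
  have z: "\<zero>\<^bsub>\<Lambda>\<^esub> \<in> carrier \<Lambda>" by (simp add: zero_L carrier_L)
  have U: "U n \<in> carrier \<Lambda>" for n
    by (induction n) (auto simp: U0 US z intro!: add_L_closed mult_L_closed one_L_closed h)
  have hz: "(h \<otimes>\<^bsub>\<Lambda>\<^esub> \<zero>\<^bsub>\<Lambda>\<^esub>) y = \<zero>" for y unfolding mult_L by (simp add: zero_L)
  have step: "U (Suc n) x = U n x" if "x < real n * e" for n x
    using that
  proof (induction n arbitrary: x)
    case 0
    then show ?case by (simp add: US U0 add_L hz one_L) (simp add: zero_L)
  next
    case (Suc n)
    have "(h \<otimes>\<^bsub>\<Lambda>\<^esub> U (Suc n)) x = (h \<otimes>\<^bsub>\<Lambda>\<^esub> U n) x"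
    proof (rule mult_L_local[OF supp _ h U])
      fix y assume "y \<le> x - e"
      then show "U (Suc n) y = U n y" using Suc.prems by (intro Suc.IH) (simp add: algebra_simps)
    qed
    then show ?case by (simp only: US[of n] US[of "Suc n"] add_L)
  qed
  have stable: "U (n + d) x = U n x" if "x < real n * e" for n d x
  proof (induction d)
    case (Suc d)
    have "real n * e \<le> real (n + d) * e" using e by (simp add: mult_right_mono)
    then have "x < real (n + d) * e" using that by linarith
    then show ?case using step Suc by simp
  qed simp
  define N where "N x = (SOME n. x < real n * e)" for x
  have N: "x < real (N x) * e" for x
    unfolding N_def by (rule someI_ex) (use reals_Archimedean3[OF e] in blast)
  define u where "u x = U (N x) x" for x
  have uU: "u x = U n x" if "x < real n * e" for x n
  proof (cases "N x \<le> n")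
    case True
    then show ?thesis using stable[OF N[of x], of "n - N x"] by (simp add: u_def)
  next
    case False
    then show ?thesis using stable[OF that, of "N x - n"] by (simp add: u_def)
  qed
  have "finite {g. g < C \<and> u g \<noteq> \<zero>}" for C
  proof -
    have "u g = U (N C) g" if "g < C" for g using N[of C] that by (intro uU) linarith
    then have "{g. g < C \<and> u g \<noteq> \<zero>} = {g. g < C \<and> U (N C) g \<noteq> \<zero>}" by auto
    then show ?thesis using left_finite[OF U] by simp
  qed
  moreover have "\<forall>g. g \<notin> \<Gamma> \<longrightarrow> u g = \<zero>" using U unfolding u_def carrier_L by blast
  ultimately have u: "u \<in> carrier \<Lambda>" unfolding carrier_L using coeff[OF U] by (simp add: u_def)
  have "u x = (\<one>\<^bsub>\<Lambda>\<^esub> \<oplus>\<^bsub>\<Lambda>\<^esub> h \<otimes>\<^bsub>\<Lambda>\<^esub> u) x" for x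
  proof -
    have "(h \<otimes>\<^bsub>\<Lambda>\<^esub> u) x = (h \<otimes>\<^bsub>\<Lambda>\<^esub> U (N x)) x"
    proof (rule mult_L_local[OF supp _ h U])
      fix y assume "y \<le> x - e"
      then show "u y = U (N x) y" using N[of x] e by (intro uU) linarith
    qed
    then have "(\<one>\<^bsub>\<Lambda>\<^esub> \<oplus>\<^bsub>\<Lambda>\<^esub> h \<otimes>\<^bsub>\<Lambda>\<^esub> u) x = U (Suc (N x)) x" by (simp add: US add_L)
    then show ?thesis using step[OF N[of x]] by (simp add: u_def)
  qed
  with u show thesis using that by blast
qed

theorem field_L: "field \<Lambda>"
proof -
  interpret L: cring \<Lambda> by (rule cring_L)
  show ?thesis
  proof (rule L.cring_fieldI2)
    have "\<zero>\<^bsub>\<Lambda>\<^esub> 0 \<noteq> \<one>\<^bsub>\<Lambda>\<^esub> 0" using zero_not_one by (simp add: zero_L one_L)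
    then show "\<zero>\<^bsub>\<Lambda>\<^esub> \<noteq> \<one>\<^bsub>\<Lambda>\<^esub>" by auto
    fix a assume a: "a \<in> carrier \<Lambda>" and "a \<noteq> \<zero>\<^bsub>\<Lambda>\<^esub>"
    then obtain g1 where "a g1 \<noteq> \<zero>" by (auto simp: zero_L)
    then obtain g0 where g0: "a g0 \<noteq> \<zero>" "\<And>g. a g \<noteq> \<zero> \<Longrightarrow> g0 \<le> g"
      using min_attained[OF a] by blast
    then have G: "g0 \<in> \<Gamma>" using a unfolding carrier_L by blast
    have c: "inv (a g0) \<in> carrier K" "inv (a g0) \<otimes> a g0 = \<one>"
      using g0(1) a field_Units by auto
    define t where "t = (\<lambda>g. if g = - g0 then inv (a g0) else \<zero>)"
    have t: "t \<in> carrier \<Lambda>" unfolding t_def by (rule monom_L[OF c(1) G_uminus[OF G]])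
    have ta: "(t \<otimes>\<^bsub>\<Lambda>\<^esub> a) x = inv (a g0) \<otimes> a (x + g0)" for x
      unfolding t_def by (simp add: monom_mult[OF c(1) G_uminus[OF G] a])
    define h where "h = (\<lambda>x. if x > 0 then \<ominus> (t \<otimes>\<^bsub>\<Lambda>\<^esub> a) x else \<zero>)"
    have tac: "t \<otimes>\<^bsub>\<Lambda>\<^esub> a \<in> carrier \<Lambda>" using t a by simp
    have h: "h \<in> carrier \<Lambda>"
    proof -
      have "finite {g. g < C \<and> h g \<noteq> \<zero>}" for C
        by (rule finite_subset[OF _ left_finite[OF tac, of C]]) (auto simp: h_def)
      moreover have "\<forall>g. g \<notin> \<Gamma> \<longrightarrow> h g = \<zero>" using tac unfolding carrier_L h_def by auto
      moreover have "\<forall>g. h g \<in> carrier K" using coeff[OF tac] by (auto simp: h_def)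
      ultimately show ?thesis unfolding carrier_L by blast
    qed
    define e where "e = Min (insert 1 {g. g < 1 \<and> h g \<noteq> \<zero>})"
    have fe: "finite (insert 1 {g. g < 1 \<and> h g \<noteq> \<zero>})" using left_finite[OF h] by simp
    have e: "e > 0" unfolding e_def using fe by (subst Min_gr_iff) (auto simp: h_def split: if_splits)
    have he: "e \<le> y" if "h y \<noteq> \<zero>" for y
      unfolding e_def using that
      by (cases "y < 1") (auto intro: Min_le[OF fe] order_trans[OF Min_le[OF fe, of 1]])
    obtain u where u: "u \<in> carrier \<Lambda>" "u = \<one>\<^bsub>\<Lambda>\<^esub> \<oplus>\<^bsub>\<Lambda>\<^esub> h \<otimes>\<^bsub>\<Lambda>\<^esub> u"
      using geometric[OF h e he] by blast
    have "((t \<otimes>\<^bsub>\<Lambda>\<^esub> a) \<oplus>\<^bsub>\<Lambda>\<^esub> h) x = \<one>\<^bsub>\<Lambda>\<^esub> x" for x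
    proof -
      consider "x > 0" | "x = 0" | "x < 0" by linarith
      then show ?thesis
      proof cases
        case 1
        then show ?thesis using coeff[OF tac] by (simp add: add_L h_def one_L r_neg)
      next
        case 2
        then show ?thesis using c by (simp add: add_L h_def one_L ta)
      next
        case 3
        then have "a (x + g0) = \<zero>" using g0(2)[of "x + g0"] by force
        then show ?thesis using 3 c by (simp add: add_L h_def one_L ta)
      qed
    qed
    then have s: "(t \<otimes>\<^bsub>\<Lambda>\<^esub> a) \<oplus>\<^bsub>\<Lambda>\<^esub> h = \<one>\<^bsub>\<Lambda>\<^esub>" by blast
    have "(t \<otimes>\<^bsub>\<Lambda>\<^esub> a) \<otimes>\<^bsub>\<Lambda>\<^esub> u \<oplus>\<^bsub>\<Lambda>\<^esub> h \<otimes>\<^bsub>\<Lambda>\<^esub> u = u"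
      using s tac h u(1) L.l_distr[OF tac h u(1)] by simp
    also have "\<dots> = \<one>\<^bsub>\<Lambda>\<^esub> \<oplus>\<^bsub>\<Lambda>\<^esub> h \<otimes>\<^bsub>\<Lambda>\<^esub> u" by (rule u(2))
    finally have "(t \<otimes>\<^bsub>\<Lambda>\<^esub> a) \<otimes>\<^bsub>\<Lambda>\<^esub> u = \<one>\<^bsub>\<Lambda>\<^esub>"
      using L.add.right_cancel[of "h \<otimes>\<^bsub>\<Lambda>\<^esub> u"] tac h u(1) by simp
    then have "a \<otimes>\<^bsub>\<Lambda>\<^esub> (t \<otimes>\<^bsub>\<Lambda>\<^esub> u) = \<one>\<^bsub>\<Lambda>\<^esub>"
      using L.m_assoc[OF a t u(1)] L.m_comm[OF a t] by simp
    then show "\<exists>b\<in>carrier \<Lambda>. a \<otimes>\<^bsub>\<Lambda>\<^esub> b = \<one>\<^bsub>\<Lambda>\<^esub>" using t u(1) by blast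
  qed
qed

lemma val_attained:
  assumes "a \<in> carrier \<Lambda>" "a \<noteq> \<zero>\<^bsub>\<Lambda>\<^esub>"
  obtains g where "novikov_val K a = ereal g" "a g \<noteq> \<zero>" "\<And>g'. a g' \<noteq> \<zero> \<Longrightarrow> g \<le> g'"
proof -
  obtain g1 where g1: "a g1 \<noteq> \<zero>" using assms by (auto simp: zero_L)
  then obtain g0 where g0: "a g0 \<noteq> \<zero>" "\<And>g. a g \<noteq> \<zero> \<Longrightarrow> g0 \<le> g"
    using min_attained[OF assms(1)] by blast
  then have "(LEAST g. a g \<noteq> \<zero>) = g0" by (intro Least_equality)
  then have "novikov_val K a = ereal g0" using g1 by (auto simp: novikov_val_def)
  then show thesis using g0 that by blast
qed

end

section \<open>Orthogonalizable spaces\<close>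

text \<open>The filtration is only constrained on the carrier of the space. By \<open>field_L\<close> above, the
  requirement in \<^locale>\<open>vectorspace\<close> that the scalars form a field is met whenever \<open>K\<close> is a field and \<open>\<Gamma>\<close> a subgroup.\<close>

locale nonarch_normed_space = vectorspace "novikov K \<Gamma>" C
  for K :: "('k, 'm) ring_scheme" and \<Gamma> :: "real set"
    and C :: "(real \<Rightarrow> 'k, 'c) module" +
  fixes ell :: "'c \<Rightarrow> ereal"
  assumes ell_not_infty: "x \<in> carrier C \<Longrightarrow> ell x \<noteq> \<infinity>"
    and ell_minus_infty_iff: "x \<in> carrier C \<Longrightarrow> ell x = - \<infinity> \<longleftrightarrow> x = \<zero>\<^bsub>C\<^esub>"
    and ell_smult: "a \<in> carrier (novikov K \<Gamma>) \<Longrightarrow> x \<in> carrier C \<Longrightarrow>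
      ell (a \<odot>\<^bsub>C\<^esub> x) = ell x - novikov_val K a"
    and ell_add: "x \<in> carrier C \<Longrightarrow> y \<in> carrier C \<Longrightarrow> ell (x \<oplus>\<^bsub>C\<^esub> y) \<le> max (ell x) (ell y)"

text \<open>The empty maximum is \<open>- \<infinity>\<close>, the bottom element of \<^typ>\<open>ereal\<close>.\<close>

definition orthogonal_list ::
  "('s, 'm) ring_scheme \<Rightarrow> ('s, 'c) module \<Rightarrow> ('c \<Rightarrow> ereal) \<Rightarrow> 'c list \<Rightarrow> bool" where
  "orthogonal_list L C ell ws \<longleftrightarrow> set ws \<subseteq> carrier C \<and>
    (\<forall>a \<in> {..<length ws} \<rightarrow> carrier L.
      ell (\<Oplus>\<^bsub>C\<^esub>i\<in>{..<length ws}. a i \<odot>\<^bsub>C\<^esub> (ws ! i)) = (SUP i\<in>{..<length ws}. ell (a i \<odot>\<^bsub>C\<^esub> (ws ! i))))"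

text \<open>\<open>ws\<close> is an orthogonal ordered basis of the subspace \<open>W\<close> of \<open>C\<close>.\<close>

definition orthogonal_basis ::
  "('s, 'm) ring_scheme \<Rightarrow> ('s, 'c) module \<Rightarrow> ('c \<Rightarrow> ereal) \<Rightarrow> 'c set \<Rightarrow> 'c list \<Rightarrow> bool" where
  "orthogonal_basis L C ell W ws \<longleftrightarrow>
    distinct ws \<and> vectorspace.basis L (C\<lparr>carrier := W\<rparr>) (set ws) \<and> orthogonal_list L C ell ws"

locale orthogonalizable_space = nonarch_normed_space +
  assumes finite_dimensional: "fin_dim"
    and orthogonal_basis_exists: "\<exists>ws. orthogonal_basis (novikov K \<Gamma>) C ell (carrier C) ws"

section \<open>Singular value decompositions\<close>

definition rank_map ::
  "('s, 'm) ring_scheme \<Rightarrow> ('s, 'c) module \<Rightarrow> ('s, 'd) module \<Rightarrow> ('c \<Rightarrow> 'd) \<Rightarrow> nat" where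
  "rank_map L C D A = vectorspace.dim L (D\<lparr>carrier := mod_hom.im C A\<rparr>)"

text \<open>Lists are indexed from \<open>0\<close>, so \<open>ys ! i\<close> is the vector usually written $y_{i+1}$.\<close>

definition singular_value_decomposition ::
  "('s, 'm) ring_scheme \<Rightarrow> ('s, 'c) module \<Rightarrow> ('c \<Rightarrow> ereal) \<Rightarrow> ('s, 'd) module \<Rightarrow> ('d \<Rightarrow> ereal) \<Rightarrow>
    ('c \<Rightarrow> 'd) \<Rightarrow> 'c list \<Rightarrow> 'd list \<Rightarrow> bool" where
  "singular_value_decomposition L C ell\<^sub>C D ell\<^sub>D A ys xs \<longleftrightarrow>
    orthogonal_basis L C ell\<^sub>C (carrier C) ys \<and>
    orthogonal_basis L D ell\<^sub>D (carrier D) xs \<and>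
    orthogonal_basis L C ell\<^sub>C (mod_hom.ker C D A) (drop (rank_map L C D A) ys) \<and>
    orthogonal_basis L D ell\<^sub>D (mod_hom.im C A) (take (rank_map L C D A) xs) \<and>
    (\<forall>i < rank_map L C D A. A (ys ! i) = xs ! i) \<and>
    (\<forall>i j. i \<le> j \<and> j < rank_map L C D A \<longrightarrow>
      ell\<^sub>C (ys ! i) - ell\<^sub>D (xs ! i) \<ge> ell\<^sub>C (ys ! j) - ell\<^sub>D (xs ! j))"

section \<open>Two-term complexes and robustness\<close>

locale two_term_floer_complex =
  C1: orthogonalizable_space K \<Gamma> C\<^sub>1 ell\<^sub>1 + C0: orthogonalizable_space K \<Gamma> C\<^sub>0 ell\<^sub>0 +
  linear_map "novikov K \<Gamma>" C\<^sub>1 C\<^sub>0 bd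
  for K :: "('k, 'm) ring_scheme" and \<Gamma> :: "real set"
    and C\<^sub>1 :: "(real \<Rightarrow> 'k, 'c) module" and ell\<^sub>1
    and C\<^sub>0 :: "(real \<Rightarrow> 'k, 'd) module" and ell\<^sub>0 and bd +
  assumes filtered: "x \<in> carrier C\<^sub>1 \<Longrightarrow> ell\<^sub>0 (bd x) \<le> ell\<^sub>1 x"

definition robust_element ::
  "('s, 'c) module \<Rightarrow> ('c \<Rightarrow> ereal) \<Rightarrow> ('d \<Rightarrow> ereal) \<Rightarrow> ('c \<Rightarrow> 'd) \<Rightarrow> real \<Rightarrow> 'd \<Rightarrow> bool" where
  "robust_element C\<^sub>1 ell\<^sub>1 ell\<^sub>0 bd \<delta> x \<longleftrightarrow> (\<forall>y\<in>carrier C\<^sub>1. bd y = x \<longrightarrow> ell\<^sub>1 y > ell\<^sub>0 x + ereal \<delta>)"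

definition robust_subspace ::
  "('s, 'm) ring_scheme \<Rightarrow> ('s, 'c) module \<Rightarrow> ('c \<Rightarrow> ereal) \<Rightarrow> ('s, 'd) module \<Rightarrow> ('d \<Rightarrow> ereal) \<Rightarrow>
    ('c \<Rightarrow> 'd) \<Rightarrow> real \<Rightarrow> 'd set \<Rightarrow> bool" where
  "robust_subspace L C\<^sub>1 ell\<^sub>1 C\<^sub>0 ell\<^sub>0 bd \<delta> V \<longleftrightarrow>
    subspace L V C\<^sub>0 \<and> (\<forall>x \<in> V - {\<zero>\<^bsub>C\<^sub>0\<^esub>}. robust_element C\<^sub>1 ell\<^sub>1 ell\<^sub>0 bd \<delta> x)"

text \<open>The supremum is taken in \<^typ>\<open>ereal\<close>, so it is meaningful without a boundedness proof.\<close>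

definition beta ::
  "('s, 'm) ring_scheme \<Rightarrow> ('s, 'c) module \<Rightarrow> ('c \<Rightarrow> ereal) \<Rightarrow> ('s, 'd) module \<Rightarrow> ('d \<Rightarrow> ereal) \<Rightarrow>
    ('c \<Rightarrow> 'd) \<Rightarrow> nat \<Rightarrow> ereal" where
  "beta L C\<^sub>1 ell\<^sub>1 C\<^sub>0 ell\<^sub>0 bd k =
    Sup ({0} \<union> {ereal \<delta> | \<delta>. \<delta> \<ge> 0 \<and>
      (\<exists>V. robust_subspace L C\<^sub>1 ell\<^sub>1 C\<^sub>0 ell\<^sub>0 bd \<delta> V \<and> V \<subseteq> mod_hom.im C\<^sub>1 bd \<and>
           vectorspace.dim L (C\<^sub>0\<lparr>carrier := V\<rparr>) = k)})"

end

theory Submission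
  imports Defs
begin

text \<open>Write \<open>\<sigma>\<^sub>i = \<ell>(y\<^sub>i) - \<ell>(x\<^sub>i)\<close> (the \<open>gap (i - 1)\<close> below). Every preimage of
  \<open>x = \<Sum>\<^sub>i\<^sub>\<le>\<^sub>k \<lambda>\<^sub>i x\<^sub>i\<close> differs from \<open>\<Sum>\<^sub>i\<^sub>\<le>\<^sub>k \<lambda>\<^sub>i y\<^sub>i\<close> by an element of the kernel, which is spanned by
  \<open>y\<^sub>i\<close> with \<open>i > r\<close>; by orthogonality its filtration level is at least \<open>\<ell>(x) + \<sigma>\<^sub>k\<close>, so the span of
  \<open>x\<^sub>1, \<dots>, x\<^sub>k\<close> is \<open>\<delta>\<close>-robust for every \<open>\<delta> < \<sigma>\<^sub>k\<close>. Conversely, a \<open>k\<close>-dimensional subspace of the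
  \<open>r\<close>-dimensional image meets the span of \<open>x\<^sub>k, \<dots>, x\<^sub>r\<close> nontrivially, and
  \<open>\<Sum>\<^sub>i\<^sub>\<ge>\<^sub>k \<lambda>\<^sub>i y\<^sub>i\<close> is a preimage of \<open>x = \<Sum>\<^sub>i\<^sub>\<ge>\<^sub>k \<lambda>\<^sub>i x\<^sub>i\<close> of level at most \<open>\<ell>(x) + \<sigma>\<^sub>k\<close>.\<close>

section \<open>Linear algebra: indexed sums, independence and bases of subspaces\<close>

context module
begin

text \<open>Orthogonality is phrased with coefficients indexed by list positions, whereas
  \<open>lincomb\<close> attaches them to vectors. Injectivity of \<open>w\<close> allows a
  coefficient function to be pulled back along \<open>w\<close> and the sum to be reindexed.\<close>

lemma span_imageE:
  assumes "finite I" "inj_on w I" "w ` I \<subseteq> carrier M" "v \<in> span (w ` I)"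
  obtains a where "a \<in> I \<rightarrow> carrier R" "v = (\<Oplus>\<^bsub>M\<^esub>i\<in>I. a i \<odot>\<^bsub>M\<^esub> w i)"
proof -
  obtain b where b: "b \<in> w ` I \<rightarrow> carrier R" "lincomb b (w ` I) = v"
    using finite_in_span[of "w ` I" v] assms by blast
  have "v = (\<Oplus>\<^bsub>M\<^esub>i\<in>I. b (w i) \<odot>\<^bsub>M\<^esub> w i)"
    unfolding b(2)[symmetric] lincomb_def using b(1) assms
    by (subst M.add.finprod_reindex) auto
  then show thesis using b(1) that[of "\<lambda>i. b (w i)"] by auto
qed

end

context mod_hom
begin

lemma hom_indexed_sum:
  assumes "finite I" "g \<in> I \<rightarrow> carrier M"
  shows "f (\<Oplus>\<^bsub>M\<^esub>i\<in>I. g i) = (\<Oplus>\<^bsub>N\<^esub>i\<in>I. f (g i))"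
  using assms
proof (induction I rule: finite_induct)
  case empty
  then show ?case by simp
next
  case (insert j I)
  then have "(\<Oplus>\<^bsub>N\<^esub>i\<in>insert j I. f (g i)) = f (g j) \<oplus>\<^bsub>N\<^esub> (\<Oplus>\<^bsub>N\<^esub>i\<in>I. f (g i))"
    by (intro N.M.finsum_insert) auto
  with insert show ?case by (simp add: Pi_iff)
qed

end

context vectorspace
begin

text \<open>A common element would lie in both spans, hence be zero, which no independent set
  contains. In a linear relation over the union, the part over \<open>A\<close> is the negative of
  the part over \<open>B\<close>; so it lies in both spans and vanishes, and then the other part
  vanishes too.\<close>

lemma lin_indpt_Un:
  assumes fin: "finite A" "finite B"
    and sub: "A \<subseteq> carrier V" "B \<subseteq> carrier V"
    and li: "lin_indpt A" "lin_indpt B"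
    and int: "span A \<inter> span B \<subseteq> {\<zero>\<^bsub>V\<^esub>}"
  shows "A \<inter> B = {}" "lin_indpt (A \<union> B)"
proof -
  show disj: "A \<inter> B = {}"
    using int in_own_span[OF sub(1)] in_own_span[OF sub(2)] vs_zero_lin_dep[OF sub(1) li(1)] by blast
  show "lin_indpt (A \<union> B)"
  proof (rule finite_lin_indpt2)
    show "finite (A \<union> B)" "A \<union> B \<subseteq> carrier V" using fin sub by auto
    fix a assume a: "a \<in> A \<union> B \<rightarrow> carrier K" and z: "lincomb a (A \<union> B) = \<zero>\<^bsub>V\<^esub>"
    have aA: "a \<in> A \<rightarrow> carrier K" and aB: "a \<in> B \<rightarrow> carrier K" using a by auto
    have cA: "lincomb a A \<in> carrier V" and cB: "lincomb a B \<in> carrier V"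
      using sub aA aB by auto
    have s: "lincomb a A \<oplus>\<^bsub>V\<^esub> lincomb a B = \<zero>\<^bsub>V\<^esub>"
      using z lincomb_union[of A B a] fin sub disj a by auto
    then have "lincomb a A = \<ominus>\<^bsub>V\<^esub> lincomb a B"
      using M.minus_equality[OF _ cB cA] by simp
    moreover have "lincomb a A \<in> span A" "lincomb a B \<in> span B"
      using fin aA aB unfolding span_def by auto
    moreover have "\<ominus>\<^bsub>V\<^esub> v \<in> span B" if "v \<in> span B" for v
      using span_neg[OF sub(2)] that by blast
    ultimately have zA: "lincomb a A = \<zero>\<^bsub>V\<^esub>" using int by fastforce
    then have zB: "lincomb a B = \<zero>\<^bsub>V\<^esub>" using s cB by simp
    show "\<forall>v\<in>A \<union> B. a v = \<zero>\<^bsub>K\<^esub>"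
      using lin_dep_crit[OF fin(1) order_refl aA _ _ zA] lin_dep_crit[OF fin(2) order_refl aB _ _ zB] li
      by blast
  qed
qed

text \<open>Span and independence of a subset of \<open>W\<close> are the same in \<open>W\<close>
  and in \<open>V\<close>. This moves the bases of kernel and image from the restricted modules to
  the ambient spaces, where all later arguments take place.\<close>

lemma subspace_basis_iff:
  assumes "subspace K W V"
  shows "vectorspace.basis K (vs W) B \<longleftrightarrow> B \<subseteq> W \<and> lin_indpt B \<and> span B = W"
proof -
  interpret W: vectorspace K "vs W" by (rule subspace_is_vs[OF assms])
  show ?thesis
  proof (cases "B \<subseteq> W")
    case True
    then show ?thesis
      unfolding W.basis_def using span_li_not_depend[OF True is_module[OF assms]] by simp
  next
    case False
    then show ?thesis by (simp add: W.basis_def)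
  qed
qed

text \<open>Independent subsets of \<open>W\<close> stay independent in \<open>V\<close>, so their
  cardinality is at most \<open>dim\<close>. Hence a maximal one exists, and it is a finite basis of
  \<open>W\<close>.\<close>

lemma subspace_finite_basis:
  assumes "fin_dim" "subspace K W V"
  obtains B where "finite B" "B \<subseteq> W" "lin_indpt B" "span B = W"
    "card B = vectorspace.dim K (vs W)"
proof -
  interpret W: vectorspace K "vs W" by (rule subspace_is_vs[OF assms(2)])
  have Wc: "W \<subseteq> carrier V" using is_module[OF assms(2)] unfolding submodule_def by blast
  have li: "W.lin_dep S = lin_dep S" if "S \<subseteq> W" for S
    using span_li_not_depend(2)[OF that is_module[OF assms(2)]] .
  have "\<exists>A. finite A \<and> maximal A (\<lambda>S. S \<subseteq> carrier (vs W) \<and> W.lin_indpt S)"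
  proof (rule maximal_exists)
    show "finite A \<and> card A \<le> dim" if "A \<subseteq> carrier (vs W) \<and> W.lin_indpt A" for A
      using that li Wc li_le_dim[OF assms(1), of A] by auto
    show "{} \<subseteq> carrier (vs W) \<and> W.lin_indpt {}" by (auto simp: W.lin_dep_def)
  qed
  then obtain B where B: "finite B" "maximal B (\<lambda>S. S \<subseteq> carrier (vs W) \<and> W.lin_indpt S)"
    by blast
  then have bas: "W.basis B" using W.max_li_is_basis by blast
  then show thesis
    using that[of B] B(1) W.dim_basis[OF B(1) bas] subspace_basis_iff[OF assms(2)] by simp
qed

end

section \<open>Filtration levels of sums over part of an orthogonal list\<close>

context nonarch_normed_space
begin

lemma ell_lin_indpt_finite:
  assumes "lin_indpt S" "S \<subseteq> carrier C" "x \<in> S"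
  shows "\<bar>ell x\<bar> \<noteq> \<infinity>"
proof -
  have "x \<noteq> \<zero>\<^bsub>C\<^esub>" "x \<in> carrier C" using vs_zero_lin_dep[OF assms(2,1)] assms by auto
  then show ?thesis
    using ell_not_infty[of x] ell_minus_infty_iff[of x] by (cases "ell x") auto
qed

text \<open>Orthogonality speaks of the full list, so the coefficients are extended by zero outside
  \<open>I\<close>. The added terms are zero vectors; their level is the bottom element of
  \<open>ereal\<close> and does not affect the supremum.\<close>

lemma orthogonal_list_partial_sum:
  assumes orth: "orthogonal_list (novikov K \<Gamma>) C ell ws"
    and I: "I \<subseteq> {..<length ws}" and a: "a \<in> I \<rightarrow> carrier (novikov K \<Gamma>)"
  shows "ell (\<Oplus>\<^bsub>C\<^esub>i\<in>I. a i \<odot>\<^bsub>C\<^esub> (ws ! i)) = (SUP i\<in>I. ell (a i \<odot>\<^bsub>C\<^esub> (ws ! i)))"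
proof -
  have ws: "ws ! i \<in> carrier C" if "i < length ws" for i
    using orth that nth_mem unfolding orthogonal_list_def by blast
  define b where "b i = (if i \<in> I then a i else \<zero>\<^bsub>novikov K \<Gamma>\<^esub>)" for i
  have b: "b \<in> {..<length ws} \<rightarrow> carrier (novikov K \<Gamma>)"
    using a by (auto simp: b_def)
  have off: "b i \<odot>\<^bsub>C\<^esub> (ws ! i) = \<zero>\<^bsub>C\<^esub>" if "i \<in> {..<length ws} - I" for i
    using that ws by (auto simp: b_def)
  have summand: "b i \<odot>\<^bsub>C\<^esub> (ws ! i) \<in> carrier C" if "i < length ws" for i
    using that ws b by auto
  have "(\<Oplus>\<^bsub>C\<^esub>i\<in>I. a i \<odot>\<^bsub>C\<^esub> (ws ! i)) = (\<Oplus>\<^bsub>C\<^esub>i\<in>{..<length ws}. b i \<odot>\<^bsub>C\<^esub> (ws ! i))"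
    using off I summand by (intro M.add.finprod_mono_neutral_cong_left) (auto simp: b_def)
  also have "ell \<dots> = (SUP i\<in>{..<length ws}. ell (b i \<odot>\<^bsub>C\<^esub> (ws ! i)))"
    using orth b unfolding orthogonal_list_def by blast
  also have "\<dots> = (SUP i\<in>I. ell (a i \<odot>\<^bsub>C\<^esub> (ws ! i)))"
  proof (rule antisym)
    show "(SUP i\<in>{..<length ws}. ell (b i \<odot>\<^bsub>C\<^esub> (ws ! i))) \<le> (SUP i\<in>I. ell (a i \<odot>\<^bsub>C\<^esub> (ws ! i)))"
    proof (rule SUP_least)
      fix i assume i: "i \<in> {..<length ws}"
      show "ell (b i \<odot>\<^bsub>C\<^esub> (ws ! i)) \<le> (SUP i\<in>I. ell (a i \<odot>\<^bsub>C\<^esub> (ws ! i)))"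
      proof (cases "i \<in> I")
        case True
        then show ?thesis by (auto simp: b_def intro: SUP_upper)
      next
        case False
        then show ?thesis using off[of i] i ell_minus_infty_iff[of "\<zero>\<^bsub>C\<^esub>"] by auto
      qed
    qed
    show "(SUP i\<in>I. ell (a i \<odot>\<^bsub>C\<^esub> (ws ! i))) \<le> (SUP i\<in>{..<length ws}. ell (b i \<odot>\<^bsub>C\<^esub> (ws ! i)))"
      using I by (intro SUP_mono) (auto simp: b_def)
  qed
  finally show ?thesis .
qed

text \<open>A nonzero sum forces \<open>I\<close> to be nonempty, and the supremum of a finite
  nonempty family is a maximum.\<close>

lemma orthogonal_list_partial_sum_attained:
  assumes orth: "orthogonal_list (novikov K \<Gamma>) C ell ws"
    and I: "I \<subseteq> {..<length ws}" and a: "a \<in> I \<rightarrow> carrier (novikov K \<Gamma>)"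
    and ne: "(\<Oplus>\<^bsub>C\<^esub>i\<in>I. a i \<odot>\<^bsub>C\<^esub> (ws ! i)) \<noteq> \<zero>\<^bsub>C\<^esub>"
  obtains j where "j \<in> I"
    "ell (\<Oplus>\<^bsub>C\<^esub>i\<in>I. a i \<odot>\<^bsub>C\<^esub> (ws ! i)) = ell (a j \<odot>\<^bsub>C\<^esub> (ws ! j))"
proof -
  have fin: "finite I" using I finite_subset by blast
  have "I \<noteq> {}" using ne by auto
  then have "(SUP i\<in>I. ell (a i \<odot>\<^bsub>C\<^esub> (ws ! i))) \<in> (\<lambda>i. ell (a i \<odot>\<^bsub>C\<^esub> (ws ! i))) ` I"
    using fin Max_in[of "(\<lambda>i. ell (a i \<odot>\<^bsub>C\<^esub> (ws ! i))) ` I"]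
      Max_Sup[of "(\<lambda>i. ell (a i \<odot>\<^bsub>C\<^esub> (ws ! i))) ` I"] by simp
  then show thesis using that orthogonal_list_partial_sum[OF orth I a] by auto
qed

end

text \<open>\<open>drop\<close> renumbers its entries from 0. With the original indices kept, sums
  over the kernel basis can be merged with sums over the leading entries of the same list.\<close>

lemma image_nth_drop: "(!) xs ` {n..<length xs} = set (drop n xs)"
proof
  show "(!) xs ` {n..<length xs} \<subseteq> set (drop n xs)"
  proof
    fix x assume "x \<in> (!) xs ` {n..<length xs}"
    then obtain i where "n \<le> i" "i < length xs" "x = xs ! i" by auto
    then have "x = drop n xs ! (i - n)" "i - n < length (drop n xs)" by auto
    then show "x \<in> set (drop n xs)" by (metis nth_mem)
  qed
  show "set (drop n xs) \<subseteq> (!) xs ` {n..<length xs}"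
    by (auto simp: in_set_conv_nth)
qed

section \<open>Consequences of a singular value decomposition\<close>

locale svd_two_term_complex = two_term_floer_complex +
  fixes ys :: "'c list" and xs :: "'d list"
  assumes svd: "singular_value_decomposition (novikov K \<Gamma>) C\<^sub>1 ell\<^sub>1 C\<^sub>0 ell\<^sub>0 bd ys xs"
begin

definition rk :: nat where "rk = rank_map (novikov K \<Gamma>) C\<^sub>1 C\<^sub>0 bd"

definition gap :: "nat \<Rightarrow> ereal" where "gap i = ell\<^sub>1 (ys ! i) - ell\<^sub>0 (xs ! i)"

lemma distinct_ys: "distinct ys" and distinct_xs: "distinct xs"
  and orthogonal_ys: "orthogonal_list (novikov K \<Gamma>) C\<^sub>1 ell\<^sub>1 ys"
  and orthogonal_xs: "orthogonal_list (novikov K \<Gamma>) C\<^sub>0 ell\<^sub>0 xs"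
  and basis_ys: "C1.basis (set ys)" and basis_xs: "C0.basis (set xs)"
  and bd_ys: "i < rk \<Longrightarrow> bd (ys ! i) = xs ! i"
  and gap_antimono: "i \<le> j \<Longrightarrow> j < rk \<Longrightarrow> gap j \<le> gap i"
  using svd unfolding singular_value_decomposition_def orthogonal_basis_def rk_def gap_def by auto

lemma span_kernel: "C1.span (set (drop rk ys)) = ker"
  and dim_kernel: "vectorspace.dim (novikov K \<Gamma>) (C1.vs ker) = length ys - rk"
proof -
  interpret S: vectorspace "novikov K \<Gamma>" "C1.vs ker"
    by (rule C1.subspace_is_vs[OF kerT_is_subspace])
  have b: "S.basis (set (drop rk ys))"
    using svd unfolding singular_value_decomposition_def orthogonal_basis_def rk_def by blast
  then show "C1.span (set (drop rk ys)) = ker"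
    using C1.subspace_basis_iff[OF kerT_is_subspace] by auto
  show "S.dim = length ys - rk"
    using S.dim_basis[OF _ b] distinct_ys by (simp add: distinct_card)
qed

lemma image_basis: "C0.lin_indpt (set (take rk xs))" "C0.span (set (take rk xs)) = im"
  and rk_le_length_xs: "rk \<le> length xs"
proof -
  interpret S: vectorspace "novikov K \<Gamma>" "C0.vs im"
    by (rule C0.subspace_is_vs[OF imT_is_subspace])
  have b: "S.basis (set (take rk xs))"
    using svd unfolding singular_value_decomposition_def orthogonal_basis_def rk_def by blast
  then show "C0.lin_indpt (set (take rk xs))" "C0.span (set (take rk xs)) = im"
    using C0.subspace_basis_iff[OF imT_is_subspace] by auto
  \<comment> \<open>The rank is the size of any basis of the image; a list shorter than
    \<open>rk\<close> could not supply that many vectors.\<close>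
  have "rk = card (set (take rk xs))"
    using S.dim_basis[OF _ b] by (simp add: rk_def rank_map_def)
  then show "rk \<le> length xs"
    using distinct_xs by (simp add: distinct_card)
qed

text \<open>The subtraction in \<open>dim_kernel\<close> is truncated, so it is valid without this
  bound. Rank-nullity then gives \<open>rk + (length ys - rk) = length ys\<close>, which rules out
  truncation.\<close>

lemma rk_le_length_ys: "rk \<le> length ys"
proof -
  have "rk + (length ys - rk) = length ys"
    using rank_nullity[OF C1.finite_dimensional] C1.dim_basis[OF _ basis_ys] distinct_ys
      dim_kernel by (simp add: rk_def rank_map_def distinct_card)
  then show ?thesis by simp
qed

lemma ys_closed: "i < length ys \<Longrightarrow> ys ! i \<in> carrier C\<^sub>1"
  and xs_closed: "i < length xs \<Longrightarrow> xs ! i \<in> carrier C\<^sub>0"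
  using basis_ys basis_xs nth_mem unfolding C1.basis_def C0.basis_def by blast+

lemma ell_ys_finite: "i < length ys \<Longrightarrow> \<bar>ell\<^sub>1 (ys ! i)\<bar> \<noteq> \<infinity>"
  using C1.ell_lin_indpt_finite[of "set ys"] basis_ys unfolding C1.basis_def by auto

lemma ell_xs_finite: "i < length xs \<Longrightarrow> \<bar>ell\<^sub>0 (xs ! i)\<bar> \<noteq> \<infinity>"
  using C0.ell_lin_indpt_finite[of "set xs"] basis_xs unfolding C0.basis_def by auto

text \<open>This is the filtration condition on \<open>bd\<close> at \<open>ys ! i\<close>. It is
  needed because the supremum defining \<open>beta\<close> always includes 0.\<close>

lemma gap_nonneg: "i < rk \<Longrightarrow> 0 \<le> gap i"
  using filtered[of "ys ! i"] bd_ys[of i] ys_closed[of i] ell_xs_finite[of i]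
    rk_le_length_ys rk_le_length_xs
  by (cases "ell\<^sub>1 (ys ! i)"; cases "ell\<^sub>0 (xs ! i)") (auto simp: gap_def)

text \<open>Scaling by \<open>a\<close> lowers both levels by the valuation of \<open>a\<close>, so
  their difference is unchanged. For \<open>a\<close> zero both sides are minus infinity, since the
  gap is finite.\<close>

lemma ell_smult_ys:
  assumes "i < rk" "a \<in> carrier (novikov K \<Gamma>)"
  shows "ell\<^sub>1 (a \<odot>\<^bsub>C\<^sub>1\<^esub> ys ! i) = ell\<^sub>0 (a \<odot>\<^bsub>C\<^sub>0\<^esub> xs ! i) + gap i"
proof -
  have i: "i < length ys" "i < length xs" using assms(1) rk_le_length_ys rk_le_length_xs by auto
  have "novikov_val K a \<noteq> - \<infinity>" by (simp add: novikov_val_def)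
  then show ?thesis
    using ell_ys_finite[OF i(1)] ell_xs_finite[OF i(2)]
      C1.ell_smult[OF assms(2) ys_closed[OF i(1)]] C0.ell_smult[OF assms(2) xs_closed[OF i(2)]]
    by (cases "ell\<^sub>1 (ys ! i)"; cases "ell\<^sub>0 (xs ! i)"; cases "novikov_val K a")
      (auto simp: gap_def)
qed

lemma bd_sum:
  assumes "I \<subseteq> {..<rk}" "a \<in> I \<rightarrow> carrier (novikov K \<Gamma>)"
  shows "bd (\<Oplus>\<^bsub>C\<^sub>1\<^esub>i\<in>I. a i \<odot>\<^bsub>C\<^sub>1\<^esub> ys ! i) = (\<Oplus>\<^bsub>C\<^sub>0\<^esub>i\<in>I. a i \<odot>\<^bsub>C\<^sub>0\<^esub> xs ! i)"
proof -
  have fin: "finite I" using assms(1) finite_subset by blast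
  have a: "a i \<in> carrier (novikov K \<Gamma>)" and y: "ys ! i \<in> carrier C\<^sub>1" and x: "xs ! i \<in> carrier C\<^sub>0"
    and b: "bd (ys ! i) = xs ! i" if "i \<in> I" for i
    using that assms ys_closed[of i] xs_closed[of i] bd_ys[of i] rk_le_length_ys rk_le_length_xs by auto
  have "bd (\<Oplus>\<^bsub>C\<^sub>1\<^esub>i\<in>I. a i \<odot>\<^bsub>C\<^sub>1\<^esub> ys ! i) = (\<Oplus>\<^bsub>C\<^sub>0\<^esub>i\<in>I. bd (a i \<odot>\<^bsub>C\<^sub>1\<^esub> ys ! i))"
    using fin a y by (intro hom_indexed_sum) auto
  also have "\<dots> = (\<Oplus>\<^bsub>C\<^sub>0\<^esub>i\<in>I. a i \<odot>\<^bsub>C\<^sub>0\<^esub> xs ! i)"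
    using a y x b by (intro C0.M.finsum_cong') auto
  finally show ?thesis .
qed

lemma xs_image: "I \<subseteq> {..<rk} \<Longrightarrow> (!) xs ` I \<subseteq> set (take rk xs)"
  using nth_image[OF rk_le_length_xs] by (auto simp: atLeast0LessThan)

lemma inj_xs: "I \<subseteq> {..<rk} \<Longrightarrow> inj_on ((!) xs) I"
  using distinct_xs rk_le_length_xs by (intro inj_on_nth) auto

lemma xs_image_indpt:
  assumes "I \<subseteq> {..<rk}"
  shows "C0.lin_indpt ((!) xs ` I)" "(!) xs ` I \<subseteq> carrier C\<^sub>0" "C0.span ((!) xs ` I) \<subseteq> im"
    "card ((!) xs ` I) = card I"
proof -
  show "C0.lin_indpt ((!) xs ` I)"
    using C0.subset_li_is_li[OF image_basis(1) xs_image[OF assms]] .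
  show "(!) xs ` I \<subseteq> carrier C\<^sub>0"
    using xs_closed rk_le_length_xs assms by auto
  show "C0.span ((!) xs ` I) \<subseteq> im"
    using C0.span_is_monotone[OF xs_image[OF assms]] image_basis(2) by simp
  show "card ((!) xs ` I) = card I"
    by (rule card_image[OF inj_xs[OF assms]])
qed

section \<open>Lower bound: robustness of the span of the leading vectors\<close>

lemma robust_span:
  assumes j: "j < rk" and \<delta>: "ereal \<delta> < gap j"
  shows "robust_subspace (novikov K \<Gamma>) C\<^sub>1 ell\<^sub>1 C\<^sub>0 ell\<^sub>0 bd \<delta> (C0.span ((!) xs ` {..j}))"
  unfolding robust_subspace_def robust_element_def
proof (intro conjI ballI impI)
  have J: "{..j} \<subseteq> {..<rk}" using j by auto
  show "subspace (novikov K \<Gamma>) (C0.span ((!) xs ` {..j})) C\<^sub>0"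
    by (rule C0.span_is_subspace[OF xs_image_indpt(2)[OF J]])
  fix x y
  assume x: "x \<in> C0.span ((!) xs ` {..j}) - {\<zero>\<^bsub>C\<^sub>0\<^esub>}" and y: "y \<in> carrier C\<^sub>1" and yx: "bd y = x"
  obtain a where a: "a \<in> {..j} \<rightarrow> carrier (novikov K \<Gamma>)"
    and xa: "x = (\<Oplus>\<^bsub>C\<^sub>0\<^esub>i\<in>{..j}. a i \<odot>\<^bsub>C\<^sub>0\<^esub> xs ! i)"
    using C0.span_imageE[OF _ inj_xs[OF J] xs_image_indpt(2)[OF J]] x by blast
  \<comment> \<open>The obvious lift of \<open>x\<close>: the same coefficients on the
    \<open>ys\<close>.\<close>
  define y' where "y' = (\<Oplus>\<^bsub>C\<^sub>1\<^esub>i\<in>{..j}. a i \<odot>\<^bsub>C\<^sub>1\<^esub> ys ! i)"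
  have summand: "b i \<odot>\<^bsub>C\<^sub>1\<^esub> ys ! i \<in> carrier C\<^sub>1"
    if "b \<in> I \<rightarrow> carrier (novikov K \<Gamma>)" "i \<in> I" "i < length ys" for b I i
    using that ys_closed by auto
  have jy: "i < length ys" if "i \<le> j" for i using that j rk_le_length_ys by simp
  have y': "y' \<in> carrier C\<^sub>1"
    unfolding y'_def using summand[OF a] jy by (intro C1.M.finsum_closed) auto
  have "bd y' = x" unfolding y'_def xa by (rule bd_sum[OF J a])
  then have "y \<ominus>\<^bsub>C\<^sub>1\<^esub> y' \<in> ker"
    using y y' yx x xs_image_indpt(3)[OF J] unfolding ker_def by auto
  then have "y \<ominus>\<^bsub>C\<^sub>1\<^esub> y' \<in> C1.span ((!) ys ` {rk..<length ys})"
    using span_kernel by (simp add: image_nth_drop)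
  moreover have "inj_on ((!) ys) {rk..<length ys}"
    using distinct_ys by (intro inj_on_nth) auto
  moreover have "(!) ys ` {rk..<length ys} \<subseteq> carrier C\<^sub>1"
    using ys_closed by auto
  ultimately obtain b where b: "b \<in> {rk..<length ys} \<rightarrow> carrier (novikov K \<Gamma>)"
    and yb: "y \<ominus>\<^bsub>C\<^sub>1\<^esub> y' = (\<Oplus>\<^bsub>C\<^sub>1\<^esub>i\<in>{rk..<length ys}. b i \<odot>\<^bsub>C\<^sub>1\<^esub> ys ! i)"
    using C1.span_imageE[of "{rk..<length ys}" "(!) ys" "y \<ominus>\<^bsub>C\<^sub>1\<^esub> y'"] by blast
  \<comment> \<open>The expansions of \<open>y'\<close> and of the kernel element use disjoint index
    sets because \<open>j < rk\<close>. Joined, they expand \<open>y\<close> itself, with no terms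
    at indices strictly between \<open>j\<close> and \<open>rk\<close>.\<close>
  define c where "c i = (if i \<le> j then a i else b i)" for i
  define I where "I = {..j} \<union> {rk..<length ys}"
  have I: "I \<subseteq> {..<length ys}" using jy by (auto simp: I_def)
  have ca: "c i = a i" if "i \<le> j" for i using that by (simp add: c_def)
  have cb: "c i = b i" if "rk \<le> i" for i using that j by (simp add: c_def)
  have c: "c \<in> I \<rightarrow> carrier (novikov K \<Gamma>)" using a b by (auto simp: c_def I_def Pi_iff)
  have "y = y' \<oplus>\<^bsub>C\<^sub>1\<^esub> (y \<ominus>\<^bsub>C\<^sub>1\<^esub> y')"
    using y y' C1.M.a_lcomm[of y' y "\<ominus>\<^bsub>C\<^sub>1\<^esub> y'"] by (simp add: a_minus_def C1.M.r_neg)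
  also have "\<dots> = (\<Oplus>\<^bsub>C\<^sub>1\<^esub>i\<in>{..j}. c i \<odot>\<^bsub>C\<^sub>1\<^esub> ys ! i) \<oplus>\<^bsub>C\<^sub>1\<^esub> (\<Oplus>\<^bsub>C\<^sub>1\<^esub>i\<in>{rk..<length ys}. c i \<odot>\<^bsub>C\<^sub>1\<^esub> ys ! i)"
  proof -
    have "y' = (\<Oplus>\<^bsub>C\<^sub>1\<^esub>i\<in>{..j}. c i \<odot>\<^bsub>C\<^sub>1\<^esub> ys ! i)"
      unfolding y'_def using summand[OF c] I by (intro C1.M.finsum_cong') (auto simp: ca I_def)
    moreover have "y \<ominus>\<^bsub>C\<^sub>1\<^esub> y' = (\<Oplus>\<^bsub>C\<^sub>1\<^esub>i\<in>{rk..<length ys}. c i \<odot>\<^bsub>C\<^sub>1\<^esub> ys ! i)"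
      unfolding yb using summand[OF b] by (intro C1.M.finsum_cong') (auto simp: cb Pi_iff)
    ultimately show ?thesis by simp
  qed
  also have "\<dots> = (\<Oplus>\<^bsub>C\<^sub>1\<^esub>i\<in>I. c i \<odot>\<^bsub>C\<^sub>1\<^esub> ys ! i)"
    unfolding I_def using summand[OF c] I j
    by (intro C1.M.finsum_Un_disjoint[symmetric]) (auto simp: I_def)
  finally have "ell\<^sub>1 y = (SUP i\<in>I. ell\<^sub>1 (c i \<odot>\<^bsub>C\<^sub>1\<^esub> ys ! i))"
    using C1.orthogonal_list_partial_sum[OF orthogonal_ys I c] by simp
  \<comment> \<open>The kernel terms are further members of the supremum, so they cannot cancel the
    terms of the lift.\<close>
  then have up: "ell\<^sub>1 (a i \<odot>\<^bsub>C\<^sub>1\<^esub> ys ! i) \<le> ell\<^sub>1 y" if "i \<le> j" for i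
    using that by (auto simp: c_def I_def intro!: SUP_upper2[of i])
  have xc: "x \<in> carrier C\<^sub>0" using yx y by auto
  have Jx: "{..j} \<subseteq> {..<length xs}" using j rk_le_length_xs by auto
  obtain l where l: "l \<le> j" "ell\<^sub>0 x = ell\<^sub>0 (a l \<odot>\<^bsub>C\<^sub>0\<^esub> xs ! l)"
    using C0.orthogonal_list_partial_sum_attained[OF orthogonal_xs Jx a] x unfolding xa by auto
  \<comment> \<open>Since \<open>x\<close> is nonzero its level is real, so adding it preserves the
    strict inequality.\<close>
  have "ell\<^sub>0 x + ereal \<delta> < ell\<^sub>0 x + gap j"
    using \<delta> C0.ell_not_infty[OF xc] C0.ell_minus_infty_iff[OF xc] x
    by (cases "ell\<^sub>0 x"; cases "gap j") auto
  also have "\<dots> \<le> ell\<^sub>0 x + gap l"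
    using gap_antimono[OF l(1) j] by (rule add_left_mono)
  also have "\<dots> = ell\<^sub>1 (a l \<odot>\<^bsub>C\<^sub>1\<^esub> ys ! l)"
    using ell_smult_ys[of l "a l"] l j a by (simp add: Pi_iff)
  also have "\<dots> \<le> ell\<^sub>1 y" by (rule up[OF l(1)])
  finally show "ell\<^sub>1 y > ell\<^sub>0 x + ereal \<delta>" .
qed

lemma dim_robust_span:
  assumes "j < rk"
  shows "vectorspace.dim (novikov K \<Gamma>) (C0.vs (C0.span ((!) xs ` {..j}))) = Suc j"
proof -
  have J: "{..j} \<subseteq> {..<rk}" using assms by auto
  have sub: "subspace (novikov K \<Gamma>) (C0.span ((!) xs ` {..j})) C\<^sub>0"
    by (rule C0.span_is_subspace[OF xs_image_indpt(2)[OF J]])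
  interpret S: vectorspace "novikov K \<Gamma>" "C0.vs (C0.span ((!) xs ` {..j}))"
    by (rule C0.subspace_is_vs[OF sub])
  have "S.basis ((!) xs ` {..j})"
    using C0.subspace_basis_iff[OF sub] C0.in_own_span[OF xs_image_indpt(2)[OF J]]
      xs_image_indpt(1)[OF J] by simp
  then show ?thesis using S.dim_basis[of "(!) xs ` {..j}"] xs_image_indpt(4)[OF J] by simp
qed

section \<open>Upper bound on robust subspaces of the image\<close>

lemma card_indpt_image_le:
  assumes "A \<subseteq> im" "C0.lin_indpt A" "finite A"
  shows "card A \<le> rk"
proof -
  \<comment> \<open>Steinitz exchange against the basis \<open>take rk xs\<close> of the image: the
    completing set \<open>C\<close> has nonnegative size, which gives the inequality.\<close>
  have "\<exists>C. finite C \<and> C \<subseteq> carrier C\<^sub>0 \<and> C \<subseteq> C0.span (set (take rk xs)) \<and> C \<inter> A = {} \<and>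
      int (card C) \<le> int (card (set (take rk xs))) - int (card A) \<and>
      C0.span (A \<union> C) = C0.span (set (take rk xs))"
    using assms image_basis(2) xs_closed by (intro C0.replacement) (auto dest!: in_set_takeD simp: in_set_conv_nth)
  then have "card A \<le> card (set (take rk xs))" by auto
  then show ?thesis using card_length[of "take rk xs"] by simp
qed

text \<open>The bound on \<open>j\<close> leaves no candidates beyond the rank. The bound on
  \<delta> needs the robustness inequality for only one vector of \<open>V\<close> and one of its
  preimages.\<close>

lemma robust_subspace_bound:
  assumes rob: "robust_subspace (novikov K \<Gamma>) C\<^sub>1 ell\<^sub>1 C\<^sub>0 ell\<^sub>0 bd \<delta> V" and V: "V \<subseteq> im"
    and dim: "vectorspace.dim (novikov K \<Gamma>) (C0.vs V) = Suc j"
  shows "j < rk" "ereal \<delta> < gap j"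
proof -
  have sub: "subspace (novikov K \<Gamma>) V C\<^sub>0"
    and robV: "\<And>x y. x \<in> V \<Longrightarrow> x \<noteq> \<zero>\<^bsub>C\<^sub>0\<^esub> \<Longrightarrow> y \<in> carrier C\<^sub>1 \<Longrightarrow> bd y = x \<Longrightarrow> ell\<^sub>0 x + ereal \<delta> < ell\<^sub>1 y"
    using rob unfolding robust_subspace_def robust_element_def by blast+
  obtain B where B: "finite B" "B \<subseteq> V" "C0.lin_indpt B" "C0.span B = V" "card B = Suc j"
    using C0.subspace_finite_basis[OF C0.finite_dimensional sub] dim by metis
  show j: "j < rk" using card_indpt_image_le[OF subset_trans[OF B(2) V] B(3,1)] B(5) by simp
  \<comment> \<open>With k = \<open>Suc j\<close> and indices from 0, these are the positions of the
    kth to the rth vector.\<close>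
  define J where "J = {j..<rk}"
  have J: "J \<subseteq> {..<rk}" "finite J" by (auto simp: J_def)
  let ?X = "(!) xs ` J"
  have "\<not> V \<inter> C0.span ?X \<subseteq> {\<zero>\<^bsub>C\<^sub>0\<^esub>}"
  proof
    assume int: "V \<inter> C0.span ?X \<subseteq> {\<zero>\<^bsub>C\<^sub>0\<^esub>}"
    have "B \<subseteq> carrier C\<^sub>0" using B(2) V by (auto simp: im_def)
    note Un = C0.lin_indpt_Un[OF B(1) _ this xs_image_indpt(2)[OF J(1)] B(3) xs_image_indpt(1)[OF J(1)]]
    \<comment> \<open>The two families overlap in the index \<open>j\<close>, so a trivial
      intersection would give \<open>rk + 1\<close> independent vectors in the image.\<close>
    have "card (B \<union> ?X) = Suc j + (rk - j)"
      using Un(1) int B xs_image_indpt(4)[OF J(1)] J(2) by (subst card_Un_disjoint) (auto simp: J_def)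
    moreover have "card (B \<union> ?X) \<le> rk"
      using Un(2) int B V J(2) xs_image_indpt(3)[OF J(1)] C0.in_own_span[OF xs_image_indpt(2)[OF J(1)]]
      by (intro card_indpt_image_le) auto
    ultimately show False using j by simp
  qed
  then obtain x where x: "x \<in> V" "x \<in> C0.span ?X" "x \<noteq> \<zero>\<^bsub>C\<^sub>0\<^esub>" by blast
  obtain a where a: "a \<in> J \<rightarrow> carrier (novikov K \<Gamma>)"
    and xa: "x = (\<Oplus>\<^bsub>C\<^sub>0\<^esub>i\<in>J. a i \<odot>\<^bsub>C\<^sub>0\<^esub> xs ! i)"
    using C0.span_imageE[OF J(2) inj_xs[OF J(1)] xs_image_indpt(2)[OF J(1)] x(2)] .
  define y where "y = (\<Oplus>\<^bsub>C\<^sub>1\<^esub>i\<in>J. a i \<odot>\<^bsub>C\<^sub>1\<^esub> ys ! i)"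
  have summand: "a i \<odot>\<^bsub>C\<^sub>1\<^esub> ys ! i \<in> carrier C\<^sub>1" if "i \<in> J" for i
    using that a ys_closed[of i] J(1) rk_le_length_ys
    by (intro C1.smult_closed) auto
  have y: "y \<in> carrier C\<^sub>1" unfolding y_def using summand by (intro C1.M.finsum_closed) auto
  have yx: "bd y = x" unfolding y_def xa by (rule bd_sum[OF J(1) a])
  have "y \<noteq> \<zero>\<^bsub>C\<^sub>1\<^esub>" using yx x(3) by auto
  moreover have Jy: "J \<subseteq> {..<length ys}" and Jx: "J \<subseteq> {..<length xs}"
    using J(1) rk_le_length_ys rk_le_length_xs by auto
  ultimately obtain l where l: "l \<in> J" "ell\<^sub>1 y = ell\<^sub>1 (a l \<odot>\<^bsub>C\<^sub>1\<^esub> ys ! l)"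
    using C1.orthogonal_list_partial_sum_attained[OF orthogonal_ys Jy a] unfolding y_def by blast
  \<comment> \<open>The index \<open>l\<close> realizes the level of \<open>y\<close> but need not
    realize that of \<open>x\<close>; it suffices that its term bounds the level of \<open>x\<close>
    from below and that \<open>j \<le> l\<close> makes its gap at most \<open>gap j\<close>.\<close>
  have "ell\<^sub>0 x + ereal \<delta> < ell\<^sub>1 y" by (rule robV[OF x(1,3) y yx])
  also have "\<dots> = ell\<^sub>0 (a l \<odot>\<^bsub>C\<^sub>0\<^esub> xs ! l) + gap l"
    using ell_smult_ys[of l "a l"] l J(1) a by auto
  also have "\<dots> \<le> ell\<^sub>0 x + gap j"
  proof (rule add_mono)
    show "ell\<^sub>0 (a l \<odot>\<^bsub>C\<^sub>0\<^esub> xs ! l) \<le> ell\<^sub>0 x"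
      using C0.orthogonal_list_partial_sum[OF orthogonal_xs Jx a] l(1) unfolding xa
      by (auto intro: SUP_upper)
    show "gap l \<le> gap j" using l(1) by (intro gap_antimono) (auto simp: J_def)
  qed
  finally have lt: "ell\<^sub>0 x + ereal \<delta> < ell\<^sub>0 x + gap j" .
  have "x \<in> carrier C\<^sub>0" using yx y by auto
  then show "ereal \<delta> < gap j"
    using lt C0.ell_not_infty[of x] C0.ell_minus_infty_iff[of x] x(3)
    by (cases "ell\<^sub>0 x"; cases "gap j") auto
qed

section \<open>Evaluation of the supremum\<close>

lemma beta_eq: "beta (novikov K \<Gamma>) C\<^sub>1 ell\<^sub>1 C\<^sub>0 ell\<^sub>0 bd (Suc j) = (if j < rk then gap j else 0)"
proof -
  let ?D = "{ereal \<delta> | \<delta>. \<delta> \<ge> 0 \<and>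
      (\<exists>V. robust_subspace (novikov K \<Gamma>) C\<^sub>1 ell\<^sub>1 C\<^sub>0 ell\<^sub>0 bd \<delta> V \<and> V \<subseteq> im \<and>
           vectorspace.dim (novikov K \<Gamma>) (C0.vs V) = Suc j)}"
  have beta: "beta (novikov K \<Gamma>) C\<^sub>1 ell\<^sub>1 C\<^sub>0 ell\<^sub>0 bd (Suc j) = Sup ({0} \<union> ?D)"
    unfolding beta_def ..
  show ?thesis
  proof (cases "j < rk")
    case True
    have "Sup ({0} \<union> ?D) \<le> gap j"
      using gap_nonneg[OF True] robust_subspace_bound(2) by (intro Sup_least) (auto intro: less_imp_le)
    moreover have "gap j \<le> Sup ({0} \<union> ?D)"
    \<comment> \<open>Admissible \<delta> stay strictly below \<open>gap j\<close>, so the supremum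
      is compared with every \<open>z < gap j\<close>. Values \<open>z \<le> 0\<close> are covered
      by the element 0; any other \<open>z\<close> is a positive real and is itself admissible by
      \<open>robust_span\<close>.\<close>
    proof (rule dense_le)
      fix z assume z: "z < gap j"
      show "z \<le> Sup ({0} \<union> ?D)"
      proof (cases "z \<le> 0")
        case True
        then show ?thesis by (intro Sup_upper2[of 0]) auto
      next
        case False
        then obtain \<delta> where \<delta>: "z = ereal \<delta>" "\<delta> \<ge> 0" using z by (cases z) auto
        have "{..j} \<subseteq> {..<rk}" using \<open>j < rk\<close> by auto
        then have "z \<in> ?D"
          using \<delta> z robust_span[OF \<open>j < rk\<close>] dim_robust_span[OF \<open>j < rk\<close>] xs_image_indpt(3) by blast
        then show ?thesis by (intro Sup_upper) auto
      qed
    qed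
    ultimately show ?thesis unfolding beta using True by (simp only: if_True order.antisym)
  next
    case False
    \<comment> \<open>No subspace of the image has dimension \<open>Suc j\<close> here, so only the
      element 0 remains.\<close>
    then have "?D = {}" using robust_subspace_bound(1) by blast
    then show ?thesis unfolding beta using False by (simp only: Un_empty_right cSup_singleton if_False)
  qed
qed

end

theorem theorem4p11:
  fixes K :: "('k, 'm) ring_scheme" and \<Gamma> :: "real set"
    and C\<^sub>1 :: "(real \<Rightarrow> 'k, 'c) module" and ell\<^sub>1 :: "'c \<Rightarrow> ereal"
    and C\<^sub>0 :: "(real \<Rightarrow> 'k, 'd) module" and ell\<^sub>0 :: "'d \<Rightarrow> ereal"
    and bd :: "'c \<Rightarrow> 'd" and ys :: "'c list" and xs :: "'d list" and k :: nat
  assumes "field K"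
    and "subgroup \<Gamma> real_add_group"
    and "two_term_floer_complex K \<Gamma> C\<^sub>1 ell\<^sub>1 C\<^sub>0 ell\<^sub>0 bd"
    and "singular_value_decomposition (novikov K \<Gamma>) C\<^sub>1 ell\<^sub>1 C\<^sub>0 ell\<^sub>0 bd ys xs"
    and "k \<ge> 1"
  shows "beta (novikov K \<Gamma>) C\<^sub>1 ell\<^sub>1 C\<^sub>0 ell\<^sub>0 bd k =
    (if k \<le> rank_map (novikov K \<Gamma>) C\<^sub>1 C\<^sub>0 bd
     then ell\<^sub>1 (ys ! (k - 1)) - ell\<^sub>0 (xs ! (k - 1)) else 0)"
proof -
  interpret svd_two_term_complex K \<Gamma> C\<^sub>1 ell\<^sub>1 C\<^sub>0 ell\<^sub>0 bd ys xs
    using assms(3,4) by (simp add: svd_two_term_complex_def svd_two_term_complex_axioms_def)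
  \<comment> \<open>Positivity of \<open>k\<close> permits the shift to list positions counted from
    0.\<close>
  obtain j where "k = Suc j" using \<open>k \<ge> 1\<close> by (cases k) auto
  then show ?thesis using beta_eq[of j] by (simp add: gap_def rk_def Suc_le_eq)
qed

end
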